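(* Let $\rho\in(0,1)$ and $s(d)=d^\alpha$ with $\alpha\in(0,1)$. For $a>0$ let the income distribution be the symmetric Beta distribution on $[0,1]$ with both parameters equal to $a$ (mean $\frac12$, variance $v=\frac{1}{4(2a+1)}\in(0,\frac14)$), and let $\mathbb E(\Pi)$ be the lender's optimal expected NPV. Then, as the income variance increases (with the mean fixed), $\mathbb E(\Pi)$ first decreases and then increases; i.e. there is $v_0\in(0,\frac14)$ such that, as a function of $v$, $\mathbb E(\Pi)$ is decreasing on $(0,v_0]$ and increasing on $[v_0,\frac14)$.
   Context: Endogenous-rate lending problem with constant demand elasticity. A consumer has a fixed income $\theta\sim F$ (density $f$), unknown to the lender. In each period $t=0,1,\dots$ in which the relationship is active the lender chooses a repayment amount $y_t\ge0$ and a discount rate $d_t\in(0,\rho)$. The consumer accepts with probability $s(d_t)=d_t^\alpha$ (otherwise she exits for good); if she accepts she receives $d_ty_t$ and at the end of the period repays $y_t$ if $\theta\ge y_t$, and otherwise defaults (repays nothing) and exits. The lender maximizes the expected NPV $$\Pi(\mathbf y,\mathbf d)=\sum_{t=0}^\infty\rho^t\Big[\prod_{i=0}^{t-1}s(d_i)\mathbb P(\theta\ge y_i\mid\mathcal H_i)\Big]s(d_t)\big[\rho\,\mathbb P(\theta\ge y_t\mid\mathcal H_t)\,y_t-d_ty_t\big],$$ where $\mathcal H_t$ is the event $\theta\ge\max_{i<t}y_i$ (no information at $t=0$) and the empty product is $1$. The optimal policy (the "grand experiment") sets $y_t=\bar x$ for all $t$, $d_0=(1-F(\bar x))d^*$ and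 $d_t=d^*$ for $t\ge1$, where $\bar x$ is the unique solution of $\frac{\bar x f(\bar x)}{1-F(\bar x)}=\frac1{\alpha+1}$ and $d^*\in(0,\rho)$ is the unique solution of $\frac{1-(d^* )^{\alpha+1}}{1-(d^* )^\alpha\rho}=\frac{(1+\alpha)d^*}{\rho\alpha}$. The resulting optimal expected NPV is $\mathbb E(\Pi)=\frac{\big((1-F(\bar x))d^*\big)^{\alpha+1}}{\alpha}\,\bar x$.
   Formalization: E(Π) is taken as the NPV of the grand experiment (the context's formula), which is not always optimal (e.g. ρ=0.9, α=1/2, a near 0); for the supremum over all policies the claim is stated only at variances where the grand experiment is optimal. *)

theory Defs
  imports "HOL-Probability.Probability"
begin

text \<open>
  Throughout, \<open>M\<close> is the law of the income \<open>\<theta>\<close>, a measure on the reals, and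
  \<open>s\<close> is the acceptance probability as a function of the discount rate.
\<close>

text \<open>
  The conditional probability of \<open>\<theta> \<ge> y\<^sub>t\<close> given the event \<open>\<theta> \<ge> max\<^sub>i\<^sub><\<^sub>t y\<^sub>i\<close>; for \<open>t = 0\<close> the
  condition is the whole space.  Conditioning on a null event gives 0 (division by zero),
  which is harmless: in the NPV, the whole summand of such a period has a factor 0, because
  the product of the earlier repayment probabilities is the probability of that event.
\<close>

definition repay_prob :: "real measure \<Rightarrow> (nat \<Rightarrow> real) \<Rightarrow> nat \<Rightarrow> real" where
  "repay_prob M y t = cond_prob M (\<lambda>\<theta>. y t \<le> \<theta>) (\<lambda>\<theta>. \<forall>i<t. y i \<le> \<theta>)"

definition lender_NPV ::
  "real \<Rightarrow> (real \<Rightarrow> real) \<Rightarrow> real measure \<Rightarrow> (nat \<Rightarrow> real) \<Rightarrow> (nat \<Rightarrow> real) \<Rightarrow> real" where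
  "lender_NPV \<rho> s M y d =
     (\<Sum>t. \<rho> ^ t * (\<Prod>i<t. s (d i) * repay_prob M y i) *
           s (d t) * (\<rho> * repay_prob M y t * y t - d t * y t))"

definition policies :: "real \<Rightarrow> ((nat \<Rightarrow> real) \<times> (nat \<Rightarrow> real)) set" where
  "policies \<rho> = {(y, d). \<forall>t. 0 \<le> y t \<and> 0 < d t \<and> d t < \<rho>}"

definition optimal_policy ::
  "real \<Rightarrow> (real \<Rightarrow> real) \<Rightarrow> real measure \<Rightarrow> (nat \<Rightarrow> real) \<Rightarrow> (nat \<Rightarrow> real) \<Rightarrow> bool" where
  "optimal_policy \<rho> s M y d \<longleftrightarrow>
     (y, d) \<in> policies \<rho> \<and>
     (\<forall>(y', d') \<in> policies \<rho>. lender_NPV \<rho> s M y' d' \<le> lender_NPV \<rho> s M y d)"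

definition sup_NPV :: "real \<Rightarrow> (real \<Rightarrow> real) \<Rightarrow> real measure \<Rightarrow> real" where
  "sup_NPV \<rho> s M = (SUP (y, d) \<in> policies \<rho>. lender_NPV \<rho> s M y d)"

text \<open>
  The grand experiment for \<open>s(d) = d\<^sup>\<alpha>\<close> and the income law with density \<open>f\<close>:
  offer the repayment amount \<open>x_bar\<close> in every period, with discount rate
  \<open>(1 - F(x_bar)) d_star\<close> in period 0 and \<open>d_star\<close> afterwards.
\<close>

definition income_law :: "(real \<Rightarrow> real) \<Rightarrow> real measure" where
  "income_law f = density lborel (\<lambda>x. ennreal (f x))"

definition x_bar :: "real \<Rightarrow> (real \<Rightarrow> real) \<Rightarrow> real" where
  "x_bar \<alpha> f = (THE x. cdf (income_law f) x < 1 \<and>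
                       x * f x / (1 - cdf (income_law f) x) = 1 / (\<alpha> + 1))"

definition d_star :: "real \<Rightarrow> real \<Rightarrow> real" where
  "d_star \<rho> \<alpha> = (THE d. 0 < d \<and> d < \<rho> \<and>
     (1 - d powr (\<alpha> + 1)) / (1 - d powr \<alpha> * \<rho>) = (1 + \<alpha>) * d / (\<rho> * \<alpha>))"

definition grand_y :: "real \<Rightarrow> (real \<Rightarrow> real) \<Rightarrow> nat \<Rightarrow> real" where
  "grand_y \<alpha> f t = x_bar \<alpha> f"

definition grand_d :: "real \<Rightarrow> real \<Rightarrow> (real \<Rightarrow> real) \<Rightarrow> nat \<Rightarrow> real" where
  "grand_d \<rho> \<alpha> f t =
     (if t = 0 then (1 - cdf (income_law f) (x_bar \<alpha> f)) * d_star \<rho> \<alpha> else d_star \<rho> \<alpha>)"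

text \<open>
  \<open>grand_NPV\<close> is the optimal NPV as identified by the optimality theorem for the grand
  experiment.  That theorem is not built into any definition: \<open>grand_optimal\<close> says that the
  grand experiment maximizes the NPV among all policies, in which case \<open>grand_NPV\<close> is
  the supremum \<open>sup_NPV\<close>.  \<open>grand_optimal\<close> can fail: for \<open>\<rho> = 0.9\<close>, \<open>\<alpha> = 1/2\<close> and a symmetric Beta
  income with small parameter, a cheap first experiment with \<open>y\<^sub>0\<close> near 0 and \<open>d\<^sub>0\<close> near
  \<open>\<rho>\<close>, followed by \<open>y\<^sub>t\<close> near 1, is better.
\<close>

definition grand_NPV :: "real \<Rightarrow> real \<Rightarrow> (real \<Rightarrow> real) \<Rightarrow> real" where
  "grand_NPV \<rho> \<alpha> f =
     lender_NPV \<rho> (\<lambda>d. d powr \<alpha>) (income_law f) (grand_y \<alpha> f) (grand_d \<rho> \<alpha> f)"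

definition grand_optimal :: "real \<Rightarrow> real \<Rightarrow> (real \<Rightarrow> real) \<Rightarrow> bool" where
  "grand_optimal \<rho> \<alpha> f \<longleftrightarrow>
     optimal_policy \<rho> (\<lambda>d. d powr \<alpha>) (income_law f) (grand_y \<alpha> f) (grand_d \<rho> \<alpha> f)"

definition sym_beta_density :: "real \<Rightarrow> real \<Rightarrow> real" where
  "sym_beta_density a x =
     (if 0 < x \<and> x < 1 then x powr (a - 1) * (1 - x) powr (a - 1) / Beta a a else 0)"

text \<open>The inverse of \<open>a \<mapsto> 1 / (4 (2 a + 1))\<close>, a bijection from \<open>(0, \<infinity>)\<close> to \<open>(0, 1/4)\<close>.\<close>

definition shape_of_variance :: "real \<Rightarrow> real" where
  "shape_of_variance v = (1 / (4 * v) - 1) / 2"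

abbreviation density_of_variance :: "real \<Rightarrow> real \<Rightarrow> real" where
  "density_of_variance v \<equiv> sym_beta_density (shape_of_variance v)"

end

theory Submission
  imports Defs
begin

text \<open>
  Up to a positive factor depending only on \<open>\<rho>\<close> and \<open>\<alpha>\<close>, the NPV of the grand experiment is
  \<open>x (1 - F(x)) powr (\<alpha> + 1)\<close> at \<open>x = x_bar\<close>, and the equation for \<open>x_bar\<close> is the first order condition
  for this function; since the generalized hazard rate \<open>x f(x) / (1 - F(x))\<close> is strictly increasing,
  \<open>x_bar\<close> is its unique maximizer.  As the parameter \<open>a\<close> grows, \<open>1 - F\<close> increases to the left of 1/2
  and decreases to the right of it, so by an envelope argument the maximum increases in \<open>a\<close> while
  \<open>x_bar < 1/2\<close> and decreases while \<open>x_bar > 1/2\<close>.  The hazard rate at 1/2 is \<open>f(1/2)\<close>, which is strictly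
  increasing in \<open>a\<close>; hence \<open>x_bar\<close> crosses 1/2 exactly once, where \<open>f(1/2) = 1 / (\<alpha> + 1)\<close>.
\<close>

section \<open>The symmetric Beta density and its moments\<close>

abbreviation (input) beta_law :: "real \<Rightarrow> real measure" where
  "beta_law a \<equiv> income_law (sym_beta_density a)"

abbreviation (input) beta_cdf :: "real \<Rightarrow> real \<Rightarrow> real" where
  "beta_cdf a \<equiv> cdf (beta_law a)"

lemma Beta_pos: "0 < Beta a b" if "0 < a" "0 < b" for a b :: real
  using that by (simp add: Beta_def Gamma_real_pos)

lemma sym_beta_density_nonneg: "0 < a \<Longrightarrow> 0 \<le> sym_beta_density a x"
  by (simp add: sym_beta_density_def Beta_pos less_imp_le)

lemma sym_beta_density_pos: "0 < a \<Longrightarrow> 0 < x \<Longrightarrow> x < 1 \<Longrightarrow> 0 < sym_beta_density a x"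
  by (simp add: sym_beta_density_def Beta_pos)

lemma borel_measurable_sym_beta_density [measurable]: "sym_beta_density a \<in> borel_measurable borel"
  unfolding sym_beta_density_def by measurable

lemma continuous_on_sym_beta_density: "continuous_on {0<..<1} (sym_beta_density a)"
proof -
  have "continuous_on {0<..<1} (\<lambda>x. x powr (a - 1) * (1 - x) powr (a - 1) / Beta a a)"
    unfolding divide_inverse by (intro continuous_intros) auto
  then show ?thesis
    by (rule continuous_on_eq) (simp add: sym_beta_density_def)
qed

lemma sym_beta_density_reflect: "sym_beta_density a (1 - x) = sym_beta_density a x"
  by (simp add: sym_beta_density_def mult.commute)

text \<open>Multiplying by x^k shifts the first parameter of the Beta integral by k. The cases k =
  0, 1, 2 give total mass, mean and variance.\<close>

lemma has_bochner_integral_sym_beta_density_power: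
  assumes a: "0 < a"
  shows "has_bochner_integral lborel (\<lambda>x. sym_beta_density a x * x ^ k) (Beta (a + real k) a / Beta a a)"
proof (rule has_bochner_integral_nn_integral)
  let ?g = "\<lambda>t. t powr (a + real k - 1) * (1 - t) powr (a - 1)"
  have eq: "sym_beta_density a x * x ^ k = indicator {0..1} x * (?g x / Beta a a)" for x :: real
  proof (cases "0 < x \<and> x < 1")
    case True
    then have "x powr (a + real k - 1) = x powr (a - 1) * x ^ k"
      using powr_add[of x "a - 1" "real k"] by (simp add: powr_realpow diff_add_eq)
    with True show ?thesis by (simp add: sym_beta_density_def)
  next
    \<comment> \<open>At 0 and 1 both sides vanish because \<open>0 powr r\<close> is 0.\<close>
    case False
    then show ?thesis by (auto simp: sym_beta_density_def indicator_def)
  qed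
  have "((\<lambda>t. ?g t / Beta a a) has_integral Beta (a + real k) a / Beta a a) {0..1}"
    using a by (intro has_integral_divide has_integral_Beta_real) auto
  from nn_integral_has_integral_lebesgue[OF _ this]
  show "(\<integral>\<^sup>+x. sym_beta_density a x * x ^ k \<partial>lborel) = ennreal (Beta (a + real k) a / Beta a a)"
    unfolding eq using a by (simp add: Beta_pos less_imp_le)
  show "AE x in lborel. 0 \<le> sym_beta_density a x * x ^ k"
    unfolding eq using a by (simp add: Beta_pos less_imp_le)
  show "0 \<le> Beta (a + real k) a / Beta a a"
    using a by (simp add: Beta_pos less_imp_le add_pos_nonneg)
qed measurable

lemma
  assumes a: "0 < a"
  shows prob_space_beta_law: "prob_space (beta_law a)"
    and expectation_beta_law: "prob_space.expectation (beta_law a) (\<lambda>\<theta>. \<theta>) = 1/2"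
    and variance_beta_law: "prob_space.variance (beta_law a) (\<lambda>\<theta>. \<theta>) = 1 / (4 * (2 * a + 1))"
proof -
  have 0: "Beta a a \<noteq> 0" using Beta_pos[OF a a] by simp
  have na: "a \<notin> \<int>\<^sub>\<le>\<^sub>0" "a + 1 \<notin> \<int>\<^sub>\<le>\<^sub>0"
    using a by (auto simp: nonpos_Ints_def)
  \<comment> \<open>The recursion (a + b) B(a + 1, b) = a B(a, b), used once here and once more for
    \<open>B2\<close>, evaluates the moment quotients.\<close>
  have B1: "Beta (a + 1) a = Beta a a / 2"
    using Beta_plus1_left[OF na(1), of a] a by (simp add: field_simps)
  have B2: "Beta (a + 2) a = (a + 1) / (2 * (2 * a + 1)) * Beta a a"
    using Beta_plus1_left[OF na(2), of a] a
    by (simp add: B1 add.assoc) (simp add: field_simps)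
  note nonneg = sym_beta_density_nonneg[OF a]
  have "(\<integral>\<^sup>+x. sym_beta_density a x \<partial>lborel) = 1"
    using has_bochner_integral_sym_beta_density_power[OF a, of 0] 0 nonneg
    by (simp add: has_bochner_integral_iff nn_integral_eq_integral)
  then show ps: "prob_space (beta_law a)"
    unfolding income_law_def by (intro prob_spaceI) (simp add: emeasure_density)
  then interpret prob_space "beta_law a" .
  have mom: "integrable (beta_law a) (\<lambda>x. x ^ k) \<and>
      expectation (\<lambda>x. x ^ k) = Beta (a + real k) a / Beta a a" for k
    using has_bochner_integral_sym_beta_density_power[OF a, of k] nonneg
    unfolding income_law_def
    by (simp add: has_bochner_integral_iff integrable_density integral_density)
  show E: "expectation (\<lambda>\<theta>. \<theta>) = 1/2"
    using mom[of 1] 0 by (simp add: B1)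
  show "variance (\<lambda>\<theta>. \<theta>) = 1 / (4 * (2 * a + 1))"
  proof -
    have "variance (\<lambda>\<theta>. \<theta>) = (a + 1) / (2 * (2 * a + 1)) - (1/2)\<^sup>2"
      using mom[of 1] mom[of 2] 0 by (subst variance_eq) (simp_all add: E B2)
    also have "\<dots> = 1 / (4 * (2 * a + 1))"
      using a by (simp add: field_simps power2_eq_square)
    finally show ?thesis .
  qed
qed

section \<open>The distribution function of the symmetric Beta law\<close>

lemma real_distribution_beta_law: "0 < a \<Longrightarrow> real_distribution (beta_law a)"
  using prob_space_beta_law[of a]
  by (auto intro!: real_distribution.intro real_distribution_axioms.intro simp: income_law_def)

lemma continuous_beta_cdf:
  assumes a: "0 < a" shows "continuous_on X (beta_cdf a)"
proof -
  interpret real_distribution "beta_law a" using a by (rule real_distribution_beta_law)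
  have "measure (beta_law a) {x} = 0" for x
  proof -
    have "AE y in beta_law a. y \<notin> {x}"
      using AE_lborel_singleton[of x] unfolding income_law_def
      by (subst AE_density) auto
    then show ?thesis by (subst prob_eq_0) auto
  qed
  then show ?thesis
    by (intro continuous_at_imp_continuous_on) (simp add: isCont_cdf)
qed

lemma beta_cdf_nonpos:
  assumes a: "0 < a" and x: "x \<le> 0" shows "beta_cdf a x = 0"
proof -
  interpret real_distribution "beta_law a" using a by (rule real_distribution_beta_law)
  have "AE y in beta_law a. y \<notin> {..x}"
    using x unfolding income_law_def
    by (subst AE_density) (auto simp: sym_beta_density_def)
  then show ?thesis
    unfolding cdf_def by (subst prob_eq_0) auto
qed

lemma beta_cdf_ge_1:
  assumes a: "0 < a" and x: "1 \<le> x" shows "beta_cdf a x = 1"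
proof -
  interpret real_distribution "beta_law a" using a by (rule real_distribution_beta_law)
  have "AE y in beta_law a. y \<in> {..x}"
    using x unfolding income_law_def
    by (subst AE_density) (auto simp: sym_beta_density_def)
  then show ?thesis
    unfolding cdf_def by (subst prob_eq_1) auto
qed

lemma DERIV_beta_cdf:
  assumes a: "0 < a" and x: "0 < x" "x < 1"
  shows "(beta_cdf a has_real_derivative sym_beta_density a x) (at x)"
proof -
  interpret real_distribution "beta_law a" using a by (rule real_distribution_beta_law)
  \<comment> \<open>For a < 1 the density is unbounded near 0 and 1, so the fundamental theorem of
    calculus is applied on a compact interval around x inside the open unit interval.\<close>
  define u v where "u = x / 2" and "v = (1 + x) / 2"
  have uv: "0 < u" "u < x" "x < v" "v < 1" using x by (auto simp: u_def v_def)
  have cont: "continuous_on {u..v} (sym_beta_density a)"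
    using uv by (intro continuous_on_subset[OF continuous_on_sym_beta_density]) auto
  have eq: "beta_cdf a y = beta_cdf a u + integral {u..y} (sym_beta_density a)" if y: "y \<in> {u<..<v}" for y
  proof -
    have int: "(sym_beta_density a has_integral integral {u..y} (sym_beta_density a)) {u..y}"
      using y by (intro integrable_integral integrable_continuous_real continuous_on_subset[OF cont]) auto
    have ge0: "0 \<le> integral {u..y} (sym_beta_density a)"
      using int by (rule has_integral_nonneg) (simp add: sym_beta_density_nonneg[OF a])
    have "emeasure (beta_law a) {u<..y} = (\<integral>\<^sup>+t. ennreal (sym_beta_density a t) * indicator {u<..y} t \<partial>lborel)"
      unfolding income_law_def by (subst emeasure_density) auto
    also have "\<dots> = (\<integral>\<^sup>+t. ennreal (indicator {u..y} t * sym_beta_density a t) \<partial>lborel)"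
      using AE_lborel_singleton[of u]
      by (intro nn_integral_cong_AE, elim eventually_mono) (auto simp: indicator_def)
    also have "\<dots> = integral {u..y} (sym_beta_density a)"
      by (rule nn_integral_has_integral_lebesgue[OF _ int]) (simp add: sym_beta_density_nonneg[OF a])
    finally show ?thesis
      using cdf_diff_eq[of u y] y ge0 by (simp add: measure_def)
  qed
  have "((\<lambda>y. beta_cdf a u + integral {u..y} (sym_beta_density a)) has_real_derivative sym_beta_density a x) (at x within {u..v})"
    using integral_has_real_derivative[OF cont, of x] uv by (auto intro!: derivative_eq_intros)
  then have "((\<lambda>y. beta_cdf a u + integral {u..y} (sym_beta_density a)) has_real_derivative sym_beta_density a x) (at x)"
    using uv by (simp add: at_within_Icc_at)
  then show ?thesis
    by (rule has_field_derivative_transform_within_open[of _ _ _ "{u<..<v}"]) (use uv eq in auto)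
qed

text \<open>F(x) + F(1 - x) has derivative f(x) - f(1 - x) = 0, so it keeps its value 0 + 1 from x =
  0.\<close>

lemma beta_cdf_reflect:
  assumes a: "0 < a" and x: "0 \<le> x" "x \<le> 1"
  shows "beta_cdf a (1 - x) = 1 - beta_cdf a x"
proof -
  have "beta_cdf a x + beta_cdf a (1 - x) = beta_cdf a 0 + beta_cdf a (1 - 0)"
  proof (rule DERIV_isconst2[of 0 1])
    show "continuous_on {0..1} (\<lambda>x. beta_cdf a x + beta_cdf a (1 - x))"
      by (intro continuous_intros continuous_beta_cdf a
            continuous_on_compose2[OF continuous_beta_cdf[OF a, of UNIV]]) auto
    fix t :: real assume t: "0 < t" "t < 1"
    have "((\<lambda>t. beta_cdf a (1 - t)) has_real_derivative sym_beta_density a (1 - t) * (- 1)) (at t)"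
      by (rule DERIV_chain2[OF DERIV_beta_cdf[OF a]]) (use t in \<open>auto intro!: derivative_eq_intros\<close>)
    then show "((\<lambda>x. beta_cdf a x + beta_cdf a (1 - x)) has_real_derivative 0) (at t)"
      using DERIV_add[OF DERIV_beta_cdf[OF a t]] by (fastforce simp: sym_beta_density_reflect)
  qed (use x in auto)
  then show ?thesis
    using beta_cdf_nonpos[OF a, of 0] beta_cdf_ge_1[OF a, of 1] by simp
qed

lemma beta_cdf_half: "0 < a \<Longrightarrow> beta_cdf a (1/2) = 1/2"
  using beta_cdf_reflect[of a "1/2"] by simp

lemma beta_cdf_less_1:
  assumes a: "0 < a" and x: "0 \<le> x" "x < 1"
  shows "beta_cdf a x < 1"
proof -
  have "beta_cdf a x < beta_cdf a 1"
  proof (rule DERIV_pos_imp_increasing_open[where f = "beta_cdf a"])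
    fix t assume t: "x < t" "t < 1"
    then show "\<exists>y. (beta_cdf a has_real_derivative y) (at t) \<and> 0 < y"
      using x DERIV_beta_cdf[OF a, of t] sym_beta_density_pos[OF a, of t] by auto
  qed (use x a in \<open>auto intro: continuous_beta_cdf\<close>)
  then show ?thesis using beta_cdf_ge_1[OF a, of 1] by simp
qed

section \<open>Comparison of two symmetric Beta laws\<close>

lemma sym_beta_density_eq:
  "0 < x \<Longrightarrow> x < 1 \<Longrightarrow> sym_beta_density a x = (x * (1 - x)) powr (a - 1) / Beta a a"
  by (simp add: sym_beta_density_def powr_mult)

text \<open>The ratio of the density for b to that for a is a constant times (x (1 - x))^(b - a),
  and x (1 - x) increases up to 1/2. The inequality is the cross-multiplied form of this.\<close>

lemma sym_beta_density_ratio_less: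
  assumes "0 < a" "a < b" "0 < x" "x < y" "y \<le> 1/2"
  shows "sym_beta_density b x * sym_beta_density a y < sym_beta_density b y * sym_beta_density a x"
proof -
  define p q where "p = x * (1 - x)" and "q = y * (1 - y)"
  have "q - p = (y - x) * (1 - x - y)" by (simp add: p_def q_def algebra_simps)
  moreover have "0 < (y - x) * (1 - x - y)" using assms by simp
  ultimately have "p < q" by linarith
  moreover have "0 < p" using assms by (simp add: p_def)
  ultimately have pq: "0 < p" "p < q" by simp_all
  have split: "r powr (b - 1) = r powr (b - a) * r powr (a - 1)" for r :: real
    by (simp add: powr_add[symmetric])
  have "p powr (b - a) < q powr (b - a)"
    using assms pq by (intro powr_less_mono2) auto
  then have "p powr (b - 1) * q powr (a - 1) < q powr (b - 1) * p powr (a - 1)"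
    using pq by (simp add: split[of p] split[of q])
  then show ?thesis
    using assms Beta_pos[of a a] Beta_pos[of b b]
    by (simp add: sym_beta_density_eq p_def[symmetric] q_def[symmetric] divide_simps)
qed

text \<open>Turns information on distribution functions into information on densities. The end
  points 0 and 1 are allowed, since only continuity is used there.\<close>

lemma beta_cdf_diff_mvt:
  assumes "0 < a" "0 < b" "0 \<le> x" "x < y" "y \<le> 1"
  obtains z where "x < z" "z < y"
    "(beta_cdf b y - beta_cdf a y) - (beta_cdf b x - beta_cdf a x) =
       (sym_beta_density b z - sym_beta_density a z) * (y - x)"
proof (rule mvt[OF \<open>x < y\<close>, where f = "\<lambda>t. beta_cdf b t - beta_cdf a t"])
  show "continuous_on {x..y} (\<lambda>t. beta_cdf b t - beta_cdf a t)"
    using assms by (intro continuous_intros continuous_beta_cdf)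
  fix t assume "x < t" "t < y"
  then have "((\<lambda>t. beta_cdf b t - beta_cdf a t) has_real_derivative
      sym_beta_density b t - sym_beta_density a t) (at t)"
    using assms by (intro DERIV_diff DERIV_beta_cdf) auto
  then show "((\<lambda>t. beta_cdf b t - beta_cdf a t) has_derivative
      (*) (sym_beta_density b t - sym_beta_density a t)) (at t)"
    by (rule has_field_derivative_imp_has_derivative)
qed (use that in auto)

text \<open>
  Both distribution functions agree at 0 and 1/2, and the density ratio increases in between;
  two applications of the mean value theorem then exclude a crossing.
\<close>

lemma beta_cdf_less_lower_half:
  assumes a: "0 < a" and ab: "a < b" and x: "0 < x" "x < 1/2"
  shows "beta_cdf b x < beta_cdf a x"
proof (rule ccontr)
  assume "\<not> ?thesis"
  then have ge: "beta_cdf a x \<le> beta_cdf b x" by simp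
  have b: "0 < b" using a ab by simp
  obtain z where z: "0 < z" "z < x"
      and "(beta_cdf b x - beta_cdf a x) - (beta_cdf b 0 - beta_cdf a 0) =
        (sym_beta_density b z - sym_beta_density a z) * (x - 0)"
    using beta_cdf_diff_mvt[OF a b, of 0 x] x by auto
  with ge have "0 \<le> (sym_beta_density b z - sym_beta_density a z) * x"
    by (simp add: beta_cdf_nonpos a b)
  with x have fz: "sym_beta_density a z \<le> sym_beta_density b z"
    by (simp add: zero_le_mult_iff)
  obtain w where w: "x < w" "w < 1/2"
      and "(beta_cdf b (1/2) - beta_cdf a (1/2)) - (beta_cdf b x - beta_cdf a x) =
        (sym_beta_density b w - sym_beta_density a w) * (1/2 - x)"
    using beta_cdf_diff_mvt[OF a b, of x "1/2"] x by auto
  with ge have "(sym_beta_density b w - sym_beta_density a w) * (1/2 - x) \<le> 0"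
    by (simp add: beta_cdf_half a b)
  with x have fw: "sym_beta_density b w \<le> sym_beta_density a w"
    by (simp add: mult_le_0_iff)
  have "sym_beta_density b w * sym_beta_density a z \<le> sym_beta_density a w * sym_beta_density b z"
    using fz fw by (intro mult_mono sym_beta_density_nonneg a b)
  with sym_beta_density_ratio_less[OF a ab, of z w] z w show False
    by (simp add: mult.commute)
qed

lemma beta_cdf_less_upper_half:
  assumes a: "0 < a" and ab: "a < b" and x: "1/2 < x" "x < 1"
  shows "beta_cdf a x < beta_cdf b x"
  using beta_cdf_less_lower_half[OF a ab, of "1 - x"] assms by (simp add: beta_cdf_reflect)

text \<open>The difference of the distribution functions vanishes at 0 and at 1/2, so the densities
  agree at some z in between. Their ratio is 1 at z and increases from there to 1/2.\<close>

lemma sym_beta_density_half_less: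
  assumes a: "0 < a" and ab: "a < b"
  shows "sym_beta_density a (1/2) < sym_beta_density b (1/2)"
proof -
  have b: "0 < b" using a ab by simp
  obtain z where z: "0 < z" "z < 1/2"
      and "(beta_cdf b (1/2) - beta_cdf a (1/2)) - (beta_cdf b 0 - beta_cdf a 0) =
        (sym_beta_density b z - sym_beta_density a z) * (1/2 - 0)"
    by (rule beta_cdf_diff_mvt[OF a b, of 0 "1/2"]) auto
  then have "sym_beta_density b z = sym_beta_density a z"
    by (simp add: beta_cdf_half beta_cdf_nonpos a b)
  with sym_beta_density_ratio_less[OF a ab, of z "1/2"] sym_beta_density_pos[OF a, of z] z
  show ?thesis by simp
qed

section \<open>Monotonicity of the generalized hazard rate\<close>

lemma beta_cdf_mono:
  assumes a: "0 < a" and "x \<le> y" shows "beta_cdf a x \<le> beta_cdf a y"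
proof -
  interpret real_distribution "beta_law a" using a by (rule real_distribution_beta_law)
  show ?thesis using assms by (intro cdf_nondecreasing)
qed

text \<open>Log-concavity in four-point form. The pairs x, t + h and x + h, t have the same sum and
  the second is less spread out, so its product is larger; the same holds for the distances to 1.
  The exponent a - 1 \<ge> 0 preserves the order.\<close>

lemma sym_beta_density_log_concave:
  assumes a: "1 \<le> a" and "0 < x" "x \<le> t" "0 \<le> h" "t + h < 1"
  shows "sym_beta_density a x * sym_beta_density a (t + h) \<le> sym_beta_density a (x + h) * sym_beta_density a t"
proof -
  have "x * (t + h) \<le> (x + h) * t"
    using assms by (simp add: algebra_simps mult_left_mono)
  moreover have "(1 - x) * (1 - (t + h)) \<le> (1 - (x + h)) * (1 - t)"
    using mult_left_mono[OF \<open>x \<le> t\<close> \<open>0 \<le> h\<close>] by (simp add: algebra_simps)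
  moreover have "0 \<le> (x + h) * t" "0 \<le> (1 - x) * (1 - (t + h))"
    by (intro mult_nonneg_nonneg; use assms in linarith)+
  ultimately have "(x * (t + h)) * ((1 - x) * (1 - (t + h))) \<le> ((x + h) * t) * ((1 - (x + h)) * (1 - t))"
    by (rule mult_mono)
  then have le: "(x * (1 - x)) * ((t + h) * (1 - (t + h))) \<le> ((x + h) * (1 - (x + h))) * (t * (1 - t))"
    by (simp only: mult_ac)
  have nonneg: "0 \<le> x * (1 - x)" "0 \<le> (t + h) * (1 - (t + h))" "0 \<le> (x + h) * (1 - (x + h))" "0 \<le> t * (1 - t)"
    by (intro mult_nonneg_nonneg; use assms in linarith)+
  have "((x * (1 - x)) * ((t + h) * (1 - (t + h)))) powr (a - 1) \<le>
      (((x + h) * (1 - (x + h))) * (t * (1 - t))) powr (a - 1)"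
    using a by (intro powr_mono2 le mult_nonneg_nonneg nonneg) simp
  then have "(x * (1 - x)) powr (a - 1) * ((t + h) * (1 - (t + h))) powr (a - 1) \<le>
      ((x + h) * (1 - (x + h))) powr (a - 1) * (t * (1 - t)) powr (a - 1)"
    using nonneg by (simp only: powr_mult)
  then have "(x * (1 - x)) powr (a - 1) / Beta a a * (((t + h) * (1 - (t + h))) powr (a - 1) / Beta a a) \<le>
      ((x + h) * (1 - (x + h))) powr (a - 1) / Beta a a * ((t * (1 - t)) powr (a - 1) / Beta a a)"
    unfolding times_divide_times_eq by (rule divide_right_mono) simp
  moreover have "0 < x" "x < 1" "0 < t" "t < 1" "0 < x + h" "x + h < 1" "0 < t + h" "t + h < 1"
    using assms by linarith+
  ultimately show ?thesis
    by (simp only: sym_beta_density_eq)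
qed

text \<open>Log-concave densities have monotone hazard rates: slide both arguments to the right at
  the fixed distance y - x until the larger one reaches 1, where its survival probability is
  0.\<close>

lemma beta_hazard_mono:
  assumes a: "1 \<le> a" and xy: "0 < x" "x < y" "y < 1"
  shows "sym_beta_density a x * (1 - beta_cdf a y) \<le> sym_beta_density a y * (1 - beta_cdf a x)"
proof -
  define h where "h = y - x"
  have h: "0 < h" "y = x + h" using xy by (auto simp: h_def)
  have a0: "0 < a" using a by simp
  \<comment> \<open>\<open>?Q x \<le> 0\<close> is the claim. Log-concavity makes \<open>?Q\<close>
    nondecreasing, so it suffices that its value at t = 1 - h is not positive.\<close>
  let ?Q = "\<lambda>t. sym_beta_density a x * (1 - beta_cdf a (t + h)) - sym_beta_density a y * (1 - beta_cdf a t)"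
  have "?Q x \<le> ?Q (1 - h)"
  proof (rule DERIV_nonneg_imp_increasing_open[where f = ?Q])
    show "continuous_on {x..1 - h} ?Q"
      by (intro continuous_intros continuous_beta_cdf a0
            continuous_on_compose2[OF continuous_beta_cdf[OF a0, of UNIV]]) auto
    fix t assume t: "x < t" "t < 1 - h"
    have "((\<lambda>t. beta_cdf a (t + h)) has_real_derivative sym_beta_density a (t + h) * 1) (at t)"
      using t xy h by (intro DERIV_chain2[OF DERIV_beta_cdf[OF a0]]) (auto intro!: derivative_eq_intros)
    then have "(?Q has_real_derivative
        sym_beta_density a x * (0 - sym_beta_density a (t + h) * 1)
          - sym_beta_density a y * (0 - sym_beta_density a t)) (at t)"
      using t xy h by (intro DERIV_diff DERIV_cmult DERIV_const DERIV_beta_cdf[OF a0]) auto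
    moreover have "0 \<le> sym_beta_density a x * (0 - sym_beta_density a (t + h) * 1)
          - sym_beta_density a y * (0 - sym_beta_density a t)"
      using sym_beta_density_log_concave[OF a, of x t h] t xy h by simp
    ultimately show "\<exists>y. (?Q has_real_derivative y) (at t) \<and> 0 \<le> y" by blast
  qed (use xy h in auto)
  also have "?Q (1 - h) \<le> 0"
    using beta_cdf_ge_1[OF a0, of 1] beta_cdf_mono[OF a0, of "1 - h" 1] h sym_beta_density_nonneg[OF a0, of y]
    by simp
  finally show ?thesis by (simp add: h)
qed

text \<open>For a \<ge> 1 the hazard rate is nondecreasing and the factor x makes the growth strict.
  For a < 1 the density decreases at first, but x f(x), a multiple of x^a (1 - x)^(a - 1), is itself
  strictly increasing, while the survival probability does not increase.\<close>

lemma beta_generalized_hazard_strict_mono: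
  assumes a: "0 < a" and xy: "0 < x" "x < y" "y < 1"
  shows "x * sym_beta_density a x / (1 - beta_cdf a x) < y * sym_beta_density a y / (1 - beta_cdf a y)"
proof -
  have S: "0 < 1 - beta_cdf a x" "0 < 1 - beta_cdf a y"
    using beta_cdf_less_1[OF a] xy by auto
  have f: "0 < sym_beta_density a x" "0 < sym_beta_density a y"
    using sym_beta_density_pos[OF a] xy by auto
  show ?thesis
  proof (cases "1 \<le> a")
    case True
    from beta_hazard_mono[OF True xy] S f xy
    have "x * sym_beta_density a x * (1 - beta_cdf a y) \<le> x * sym_beta_density a y * (1 - beta_cdf a x)"
      by simp
    also have "\<dots> < y * sym_beta_density a y * (1 - beta_cdf a x)"
      using S f xy by simp
    finally show ?thesis
      using S by (simp add: divide_simps mult.commute)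
  next
    case False
    have eq: "t * sym_beta_density a t = t powr a * (1 - t) powr (a - 1) / Beta a a" if "0 < t" "t < 1" for t
      using that by (simp add: sym_beta_density_def powr_diff)
    have "x powr a * (1 - x) powr (a - 1) < y powr a * (1 - y) powr (a - 1)"
      using a xy False by (intro mult_less_le_imp_less powr_less_mono2 powr_mono2') auto
    then have "x * sym_beta_density a x < y * sym_beta_density a y"
      using xy a by (simp add: eq Beta_pos divide_strict_right_mono)
    then show ?thesis
      using f S xy beta_cdf_mono[OF a, of x y] by (intro frac_less) auto
  qed
qed

section \<open>The revenue function and its maximizer \<open>x_bar\<close>\<close>

definition revenue :: "real \<Rightarrow> real \<Rightarrow> real \<Rightarrow> real" where
  "revenue \<alpha> a x = x * (1 - beta_cdf a x) powr (\<alpha> + 1)"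

lemma revenue_pos: "0 < a \<Longrightarrow> 0 < x \<Longrightarrow> x < 1 \<Longrightarrow> 0 < revenue \<alpha> a x"
  using beta_cdf_less_1[of a x] by (simp add: revenue_def)

text \<open>With S = 1 - F(m), the derivative of the revenue at m is S^\<alpha> (S - (\<alpha> + 1)
  m f(m)), which vanishes at an interior maximum.\<close>

lemma beta_hazard_eq_at_max_revenue:
  assumes a: "0 < a" and \<alpha>: "0 < \<alpha>" and m: "0 < m" "m < 1"
    and max: "\<And>y. 0 < y \<Longrightarrow> y < 1 \<Longrightarrow> revenue \<alpha> a y \<le> revenue \<alpha> a m"
  shows "m * sym_beta_density a m / (1 - beta_cdf a m) = 1 / (\<alpha> + 1)"
proof -
  let ?S = "1 - beta_cdf a m"
  let ?D = "1 * ?S powr (\<alpha> + 1) + m * ((\<alpha> + 1) * ?S powr \<alpha> * (- sym_beta_density a m))"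
  have S: "0 < ?S" using beta_cdf_less_1[OF a, of m] m by simp
  have "((\<lambda>x. 1 - beta_cdf a x) has_real_derivative - sym_beta_density a m) (at m)"
    using m by (auto intro!: derivative_eq_intros DERIV_beta_cdf[OF a])
  from DERIV_chain2[OF has_real_derivative_powr[OF S, of "\<alpha> + 1"] this]
  have "((\<lambda>x. (1 - beta_cdf a x) powr (\<alpha> + 1)) has_real_derivative
      (\<alpha> + 1) * ?S powr \<alpha> * (- sym_beta_density a m)) (at m)"
    by simp
  from DERIV_mult[OF DERIV_ident this]
  have "(revenue \<alpha> a has_real_derivative ?D) (at m)"
    by (simp only: revenue_def[abs_def] mult.commute)
  moreover have "\<forall>y. \<bar>m - y\<bar> < min m (1 - m) \<longrightarrow> revenue \<alpha> a y \<le> revenue \<alpha> a m"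
    using max by (auto simp: abs_less_iff)
  ultimately have "?D = 0"
    using m by (intro DERIV_local_max[of "revenue \<alpha> a" ?D m "min m (1 - m)"]) auto
  then have "?S powr \<alpha> * (?S - (\<alpha> + 1) * (m * sym_beta_density a m)) = 0"
    using S by (simp add: powr_add algebra_simps)
  then have "?S = (\<alpha> + 1) * (m * sym_beta_density a m)"
    using S by simp
  then show ?thesis
    using S \<alpha> by (auto simp: divide_simps)
qed

text \<open>A maximizer n exists by compactness of [0, 1]. It is interior, because the revenue
  vanishes at both ends and is positive at 1/2, so it solves the hazard equation. Strict
  monotonicity of the generalized hazard rate leaves no other solution, which makes the definite
  description \<open>x_bar\<close> equal to n.\<close>

lemma
  fixes \<alpha> :: real
  assumes a: "0 < a" and \<alpha>: "0 < \<alpha>"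
  defines "m \<equiv> x_bar \<alpha> (sym_beta_density a)"
  shows x_bar_beta_pos: "0 < m" and x_bar_beta_less_1: "m < 1"
    and hazard_x_bar_beta: "m * sym_beta_density a m / (1 - beta_cdf a m) = 1 / (\<alpha> + 1)"
    and revenue_less_x_bar: "\<And>x. 0 < x \<Longrightarrow> x < 1 \<Longrightarrow> x \<noteq> m \<Longrightarrow> revenue \<alpha> a x < revenue \<alpha> a m"
proof -
  let ?h = "\<lambda>x. x * sym_beta_density a x / (1 - beta_cdf a x)"
  have cont: "continuous_on {0..1} (revenue \<alpha> a)"
    unfolding revenue_def[abs_def]
  proof (intro continuous_on_mult continuous_on_powr' continuous_on_diff continuous_on_const
      continuous_on_id continuous_beta_cdf a ballI)
    fix x :: real assume "x \<in> {0..1}"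
    then show "0 \<le> 1 - beta_cdf a x \<and> (1 - beta_cdf a x = 0 \<longrightarrow> 0 < \<alpha> + 1)"
      using \<alpha> beta_cdf_mono[OF a, of x 1] beta_cdf_ge_1[OF a, of 1] by simp
  qed
  then obtain n where n: "0 \<le> n" "n \<le> 1" and max: "\<And>y. 0 \<le> y \<Longrightarrow> y \<le> 1 \<Longrightarrow> revenue \<alpha> a y \<le> revenue \<alpha> a n"
    using continuous_attains_sup[OF compact_Icc _ cont] by auto
  have "0 < revenue \<alpha> a n"
    using max[of "1/2"] revenue_pos[OF a, of "1/2" \<alpha>] by simp
  then have "n \<noteq> 0" "n \<noteq> 1"
    using beta_cdf_ge_1[OF a, of 1] by (auto simp: revenue_def)
  with n have n: "0 < n" "n < 1" by auto
  have hn: "?h n = 1 / (\<alpha> + 1)"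
    using n max by (intro beta_hazard_eq_at_max_revenue a \<alpha>) auto
  have inj: "x = n" if "?h x = 1 / (\<alpha> + 1)" "0 < x" "x < 1" for x
    using beta_generalized_hazard_strict_mono[OF a, of x n] beta_generalized_hazard_strict_mono[OF a, of n x] that n hn
    by (cases x n rule: linorder_cases) auto
  have "m = n"
    unfolding m_def x_bar_def
  proof (rule the_equality)
    show "beta_cdf a n < 1 \<and> ?h n = 1 / (\<alpha> + 1)"
      using n hn beta_cdf_less_1[OF a, of n] by simp
    \<comment> \<open>The description ranges over all reals: x \<ge> 1 is excluded by F(x) < 1, and
      for x \<le> 0 the density is 0, so the quotient is 0.\<close>
    fix x assume x: "beta_cdf a x < 1 \<and> ?h x = 1 / (\<alpha> + 1)"
    then have "x < 1" using beta_cdf_ge_1[OF a, of x] by force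
    moreover have "0 < x"
    proof (rule ccontr)
      assume "\<not> 0 < x"
      then have "?h x = 0" by (simp add: sym_beta_density_def)
      with x \<alpha> show False by simp
    qed
    ultimately show "x = n" using x by (intro inj) auto
  qed
  then show "0 < m" "m < 1" "?h m = 1 / (\<alpha> + 1)"
    using n hn by simp_all
  fix x assume x: "0 < x" "x < 1" "x \<noteq> m"
  show "revenue \<alpha> a x < revenue \<alpha> a m"
  \<comment> \<open>A point with revenue at least that of n would be a maximizer as well, hence a
    second solution of the hazard equation.\<close>
  proof (rule ccontr)
    assume "\<not> ?thesis"
    then have "revenue \<alpha> a n \<le> revenue \<alpha> a x" using \<open>m = n\<close> by simp
    then have "?h x = 1 / (\<alpha> + 1)"
      using x by (intro beta_hazard_eq_at_max_revenue a \<alpha>) (auto intro: order_trans[OF max])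
    with x \<open>m = n\<close> show False using inj by auto
  qed
qed

section \<open>Dependence of the maximal revenue on the shape parameter\<close>

definition max_revenue :: "real \<Rightarrow> real \<Rightarrow> real" where
  "max_revenue \<alpha> a = revenue \<alpha> a (x_bar \<alpha> (sym_beta_density a))"

text \<open>The strictly increasing generalized hazard rate equals 1 / (\<alpha> + 1) at
  \<open>x_bar\<close> and f(1/2) at 1/2, because there x and the survival probability are both
  1/2.\<close>

lemma x_bar_beta_less_half_iff:
  assumes a: "0 < a" and \<alpha>: "0 < \<alpha>"
  shows "x_bar \<alpha> (sym_beta_density a) < 1/2 \<longleftrightarrow> 1 / (\<alpha> + 1) < sym_beta_density a (1/2)"
    and "1/2 < x_bar \<alpha> (sym_beta_density a) \<longleftrightarrow> sym_beta_density a (1/2) < 1 / (\<alpha> + 1)"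
proof -
  let ?m = "x_bar \<alpha> (sym_beta_density a)"
  let ?h = "\<lambda>x. x * sym_beta_density a x / (1 - beta_cdf a x)"
  note m = x_bar_beta_pos[OF a \<alpha>] x_bar_beta_less_1[OF a \<alpha>]
  have "?h (1/2) = sym_beta_density a (1/2)"
    by (simp add: beta_cdf_half a)
  then show "?m < 1/2 \<longleftrightarrow> 1 / (\<alpha> + 1) < sym_beta_density a (1/2)"
    and "1/2 < ?m \<longleftrightarrow> sym_beta_density a (1/2) < 1 / (\<alpha> + 1)"
    using beta_generalized_hazard_strict_mono[OF a, of ?m "1/2"]
      beta_generalized_hazard_strict_mono[OF a, of "1/2" ?m] m hazard_x_bar_beta[OF a \<alpha>]
    by (cases ?m "1/2 :: real" rule: linorder_cases; simp)+
qed

text \<open>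
  An envelope argument without derivatives: evaluate the objective of one parameter at the
  maximizer of the other.
\<close>

lemma max_revenue_strict_mono_right:
  assumes a: "0 < a" and ab: "a < b" and \<alpha>: "0 < \<alpha>" and half: "1 / (\<alpha> + 1) \<le> sym_beta_density a (1/2)"
  shows "max_revenue \<alpha> a < max_revenue \<alpha> b"
proof -
  have b: "0 < b" using a ab by simp
  let ?m = "x_bar \<alpha> (sym_beta_density a)" and ?n = "x_bar \<alpha> (sym_beta_density b)"
  note m = x_bar_beta_pos[OF a \<alpha>] x_bar_beta_less_1[OF a \<alpha>]
  have n: "?n < 1/2"
    using x_bar_beta_less_half_iff(1)[OF b \<alpha>] sym_beta_density_half_less[OF a ab] half by simp
  have m_le: "?m \<le> 1/2"
    using x_bar_beta_less_half_iff(2)[OF a \<alpha>] half by simp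
  show ?thesis
  proof (cases "?m = 1/2")
    \<comment> \<open>The distribution functions agree at 1/2, so here strictness comes from the
      maximizer for b being unique and different from 1/2.\<close>
    case True
    have "revenue \<alpha> a ?m = revenue \<alpha> b ?m"
      unfolding True by (simp add: revenue_def beta_cdf_half a b)
    also have "\<dots> < revenue \<alpha> b ?n"
      using n True by (intro revenue_less_x_bar b \<alpha>) auto
    finally show ?thesis by (simp add: max_revenue_def)
  next
    case False
    have "beta_cdf b ?m < beta_cdf a ?m"
      using m m_le False by (intro beta_cdf_less_lower_half a ab) auto
    then have "revenue \<alpha> a ?m < revenue \<alpha> b ?m"
      using m \<alpha> beta_cdf_less_1[OF a, of ?m] unfolding revenue_def
      by (intro mult_strict_left_mono powr_less_mono2) auto
    also have "\<dots> \<le> revenue \<alpha> b ?n"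
      using revenue_less_x_bar[OF b \<alpha>, of ?m] m by (cases "?m = ?n") auto
    finally show ?thesis by (simp add: max_revenue_def)
  qed
qed

text \<open>Mirror image of the previous case: both maximizers are at least 1/2, where the smaller
  parameter has the larger survival probability, so the objective for a is evaluated at the
  maximizer for b.\<close>

lemma max_revenue_strict_mono_left:
  assumes a: "0 < a" and ab: "a < b" and \<alpha>: "0 < \<alpha>" and half: "sym_beta_density b (1/2) \<le> 1 / (\<alpha> + 1)"
  shows "max_revenue \<alpha> b < max_revenue \<alpha> a"
proof -
  have b: "0 < b" using a ab by simp
  let ?m = "x_bar \<alpha> (sym_beta_density a)" and ?n = "x_bar \<alpha> (sym_beta_density b)"
  note n = x_bar_beta_pos[OF b \<alpha>] x_bar_beta_less_1[OF b \<alpha>]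
  have m: "1/2 < ?m"
    using x_bar_beta_less_half_iff(2)[OF a \<alpha>] sym_beta_density_half_less[OF a ab] half by simp
  have n_ge: "1/2 \<le> ?n"
    using x_bar_beta_less_half_iff(1)[OF b \<alpha>] half by simp
  show ?thesis
  proof (cases "?n = 1/2")
    case True
    have "revenue \<alpha> b ?n = revenue \<alpha> a ?n"
      unfolding True by (simp add: revenue_def beta_cdf_half a b)
    also have "\<dots> < revenue \<alpha> a ?m"
      using m True by (intro revenue_less_x_bar a \<alpha>) auto
    finally show ?thesis by (simp add: max_revenue_def)
  next
    case False
    have "beta_cdf a ?n < beta_cdf b ?n"
      using n n_ge False by (intro beta_cdf_less_upper_half a ab) auto
    then have "revenue \<alpha> b ?n < revenue \<alpha> a ?n"
      using n \<alpha> beta_cdf_less_1[OF b, of ?n] unfolding revenue_def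
      by (intro mult_strict_left_mono powr_less_mono2) auto
    also have "\<dots> \<le> revenue \<alpha> a ?m"
      using revenue_less_x_bar[OF a \<alpha>, of ?n] n by (cases "?n = ?m") auto
    finally show ?thesis by (simp add: max_revenue_def)
  qed
qed

section \<open>The critical shape parameter\<close>

lemma sym_beta_density_half: "sym_beta_density a (1/2) = (1/4) powr (a - 1) / Beta a a"
proof -
  have "(1/2) * (1 - 1/2) = (1/4 :: real)" by simp
  then show ?thesis using sym_beta_density_eq[of "1/2" a] by simp
qed

text \<open>For a \<le> 1 the factor (1 - t)^(a - 1) is at least 1, and without it the integral is
  B(a, 1) = 1 / a. This bounds the density at 1/2 from above for small a.\<close>

lemma Beta_ge_inverse:
  fixes a :: real
  assumes "0 < a" "a \<le> 1"
  shows "1 / a \<le> Beta a a"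
proof (rule has_integral_le)
  \<comment> \<open>The interval is open because the comparison of integrands fails at t = 1, where
    \<open>0 powr (a - 1)\<close> is 0.\<close>
  show "((\<lambda>t. t powr (a - 1) * (1 - t) powr (a - 1)) has_integral Beta a a) {0<..<1}"
    using has_integral_Beta_real[of a a] assms by (simp add: has_integral_Icc_iff_Ioo)
  have "((\<lambda>t. t powr (a - 1) * (1 - t) powr (1 - 1)) has_integral Beta a 1) {0<..<1}"
    using has_integral_Beta_real[of a 1] assms by (simp add: has_integral_Icc_iff_Ioo)
  moreover have "Beta a 1 = 1 / a"
    using assms Gamma_plus1[of a]
    by (simp add: Beta_def nonpos_Ints_def divide_simps add.commute)
      (use Gamma_real_pos[OF assms(1)] in linarith)
  ultimately have "((\<lambda>t. t powr (a - 1) * (1 - t) powr (1 - 1)) has_integral 1 / a) {0<..<1}"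
    by (simp only:)
  then show "((\<lambda>t. t powr (a - 1)) has_integral 1 / a) {0<..<1}"
    by (rule has_integral_eq[rotated]) simp
  fix t :: real assume "t \<in> {0<..<1}"
  then show "t powr (a - 1) \<le> t powr (a - 1) * (1 - t) powr (a - 1)"
    using assms powr_mono2'[of "a - 1" "1 - t" 1]
    by (simp add: mult_le_cancel_left1)
qed

text \<open>Intermediate values between a = 1/8 and the uniform law a = 1, whose density is 1. For a
  \<le> 1 the density at 1/2 is 4^(1 - a) / B(a, a) \<le> 4 a, and a = 1/8 makes this bound 1/2,
  which is below 1 / (\<alpha> + 1) because \<alpha> < 1.\<close>

lemma ex_sym_beta_density_half_eq:
  assumes \<alpha>: "0 < \<alpha>" "\<alpha> < 1"
  obtains a where "0 < a" "sym_beta_density a (1/2) = 1 / (\<alpha> + 1)"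
proof -
  have "\<exists>a\<ge>1/8. a \<le> 1 \<and> sym_beta_density a (1/2) = 1 / (\<alpha> + 1)"
  proof (rule IVT')
    show "continuous_on {1/8..1} (\<lambda>a. sym_beta_density a (1/2))"
      unfolding sym_beta_density_half Beta_def
      by (intro continuous_intros continuous_on_compose2[OF continuous_on_Gamma[of "{0<..}"]])
        (auto simp: nonpos_Ints_def Gamma_eq_zero_iff)
    show "1 / (\<alpha> + 1) \<le> sym_beta_density 1 (1/2)"
      using \<alpha> by (simp add: sym_beta_density_half Beta_def Gamma_numeral)
    have "(1/4::real) powr (1/8 - 1) \<le> (1/4) powr (- 1)"
      by (intro powr_mono') auto
    then have "sym_beta_density (1/8) (1/2) \<le> 4 / 8"
      unfolding sym_beta_density_half using Beta_ge_inverse[of "1/8"]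
      by (intro frac_le) (auto simp: powr_minus)
    also have "4/8 \<le> 1 / (\<alpha> + 1)"
      using \<alpha> by (simp add: field_simps)
    finally show "sym_beta_density (1/8) (1/2) \<le> 1 / (\<alpha> + 1)" .
  qed simp
  then obtain a where "1/8 \<le> a" "sym_beta_density a (1/2) = 1 / (\<alpha> + 1)" by blast
  then show ?thesis by (intro that[of a]) auto
qed

section \<open>The NPV of the grand experiment\<close>

text \<open>For t > 0 the condition already says x \<le> \<theta>. The assumption on the measure
  keeps this event from being null, where the conditional probability would be 0.\<close>

lemma repay_prob_const:
  assumes "prob_space M" "space M = UNIV" "measure M {x..} \<noteq> 0"
  shows "repay_prob M (\<lambda>_. x) t = (if t = 0 then measure M {x..} else 1)"
proof -
  interpret prob_space M by fact
  have eq: "{\<theta>. x \<le> \<theta>} = {x..}" by auto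
  have "(\<forall>i<t. x \<le> \<theta>) \<longleftrightarrow> t = 0 \<or> x \<le> \<theta>" for \<theta> by auto
  then show ?thesis
    using assms prob_space by (simp add: repay_prob_def cond_prob_def eq)
qed

text \<open>Once the consumer has repaid in period 0, she is known to be able to repay always. From
  period 1 on each discounted term is therefore \<rho> * s e times the one before it, and a
  geometric series remains.\<close>

lemma lender_NPV_two_rates:
  fixes M :: "real measure" and s :: "real \<Rightarrow> real"
  assumes M: "prob_space M" "space M = UNIV" "measure M {x..} \<noteq> 0"
    and d: "\<And>t. t \<noteq> 0 \<Longrightarrow> d t = e" and conv: "\<bar>\<rho> * s e\<bar> < 1"
  defines "p \<equiv> measure M {x..}"
  shows "lender_NPV \<rho> s M (\<lambda>_. x) d =
    s (d 0) * x * (\<rho> * p - d 0 + p * (\<rho> - e) * (\<rho> * s e) / (1 - \<rho> * s e))"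
proof -
  let ?f = "\<lambda>t. \<rho> ^ t * (\<Prod>i<t. s (d i) * repay_prob M (\<lambda>_. x) i) *
           s (d t) * (\<rho> * repay_prob M (\<lambda>_. x) t * x - d t * x)"
  \<comment> \<open>Only period 0 contributes the factor \<open>p\<close>; in the later periods
    repayment is certain.\<close>
  have prod: "(\<Prod>i<Suc n. s (d i) * repay_prob M (\<lambda>_. x) i) = s (d 0) * p * s e ^ n" for n
    by (subst prod.lessThan_Suc_shift) (simp add: repay_prob_const[OF M] d p_def)
  have "?f (Suc n) = (s (d 0) * p * x * (\<rho> - e) * (\<rho> * s e)) * (\<rho> * s e) ^ n" for n
    unfolding prod by (simp add: repay_prob_const[OF M] d power_mult_distrib algebra_simps)
  then have "(\<lambda>n. ?f (Suc n)) sums ((s (d 0) * p * x * (\<rho> - e) * (\<rho> * s e)) * (1 / (1 - \<rho> * s e)))"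
    using sums_mult[OF geometric_sums[of "\<rho> * s e"]] conv by (simp only: real_norm_def)
  then have "?f sums ((s (d 0) * p * x * (\<rho> - e) * (\<rho> * s e)) * (1 / (1 - \<rho> * s e)) + ?f 0)"
    by (rule sums_Suc)
  then have "lender_NPV \<rho> s M (\<lambda>_. x) d =
      (s (d 0) * p * x * (\<rho> - e) * (\<rho> * s e)) * (1 / (1 - \<rho> * s e)) + ?f 0"
    unfolding lender_NPV_def by (rule sums_unique[symmetric])
  also have "?f 0 = s (d 0) * x * (\<rho> * p - d 0)"
    by (simp add: repay_prob_const[OF M] p_def algebra_simps)
  finally show ?thesis by (simp add: distrib_left mult_ac)
qed

text \<open>Because \<open>d_star\<close> is a definite description, bounds on it require existence
  and uniqueness. With denominators cleared its equation is \<open>?g d = 0\<close>, and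
  \<open>?g\<close> is strictly decreasing, positive at 0 and negative at \<rho>.\<close>

lemma d_star_bounds:
  fixes \<rho> \<alpha> :: real
  assumes \<rho>: "0 < \<rho>" "\<rho> < 1" and \<alpha>: "0 < \<alpha>"
  shows "0 < d_star \<rho> \<alpha>" "d_star \<rho> \<alpha> < \<rho>"
proof -
  let ?g = "\<lambda>d. \<rho> * \<alpha> + \<rho> * d powr (\<alpha> + 1) - (1 + \<alpha>) * d"
  let ?P = "\<lambda>d. 0 < d \<and> d < \<rho> \<and>
     (1 - d powr (\<alpha> + 1)) / (1 - d powr \<alpha> * \<rho>) = (1 + \<alpha>) * d / (\<rho> * \<alpha>)"
  have lt1: "\<rho> * d powr \<alpha> < 1" if "0 < d" "d < \<rho>" for d
  proof -
    have "d powr \<alpha> < 1" using that \<rho> \<alpha> powr_less_mono2[of \<alpha> d 1] by simp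
    then show ?thesis using \<rho> mult_strict_mono[of \<rho> 1 "d powr \<alpha>" 1] by simp
  qed
  have P_iff: "?P d \<longleftrightarrow> 0 < d \<and> d < \<rho> \<and> ?g d = 0" for d
  proof (cases "0 < d \<and> d < \<rho>")
    case True
    have "?P d \<longleftrightarrow> (1 - d powr (\<alpha> + 1)) * (\<rho> * \<alpha>) = (1 + \<alpha>) * d * (1 - d powr \<alpha> * \<rho>)"
      using True lt1[of d] \<rho> \<alpha> by (simp add: frac_eq_eq mult.commute)
    also have "\<dots> \<longleftrightarrow> ?g d = 0"
      using True by (simp add: powr_add algebra_simps)
    finally show ?thesis using True by blast
  qed auto
  have cont: "continuous_on {x..y} ?g" if "0 \<le> x" for x y
    using \<alpha> that by (intro continuous_intros continuous_on_powr') auto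
  have dec: "?g y < ?g x" if "0 < x" "x < y" "y < \<rho>" for x y
  proof (rule DERIV_neg_imp_decreasing_open[where f = ?g])
    fix t assume t: "x < t" "t < y"
    have "(?g has_real_derivative \<rho> * ((\<alpha> + 1) * t powr \<alpha>) - (1 + \<alpha>)) (at t)"
      using t that has_real_derivative_powr[of t "\<alpha> + 1"] by (auto intro!: derivative_eq_intros)
    moreover have "\<rho> * ((\<alpha> + 1) * t powr \<alpha>) - (1 + \<alpha>) = (1 + \<alpha>) * (\<rho> * t powr \<alpha> - 1)"
      by (simp add: algebra_simps)
    moreover have "(1 + \<alpha>) * (\<rho> * t powr \<alpha> - 1) < 0"
      using lt1[of t] t that \<alpha> by (intro mult_pos_neg) auto
    ultimately show "\<exists>y. (?g has_real_derivative y) (at t) \<and> y < 0" by metis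
  qed (use that cont in auto)
  have g0: "0 < ?g 0" using \<rho> \<alpha> by simp
  have "\<rho> powr (\<alpha> + 1) < 1"
    using \<rho> \<alpha> powr_less_mono2[of "\<alpha> + 1" \<rho> 1] by simp
  then have "\<rho> * \<rho> powr (\<alpha> + 1) < \<rho> * 1"
    using \<rho> by (intro mult_strict_left_mono) auto
  then have g\<rho>: "?g \<rho> < 0" by (simp add: algebra_simps)
  obtain d where d: "0 \<le> d" "d \<le> \<rho>" "?g d = 0"
    using IVT2'[of ?g \<rho> 0 0, OF _ _ _ cont] g0 g\<rho> \<rho> by auto
  have "d \<noteq> 0" using d(3) g0 by (metis less_irrefl)
  moreover have "d \<noteq> \<rho>" using d(3) g\<rho> by (metis less_irrefl)
  ultimately have d': "0 < d" "d < \<rho>" using d by auto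
  have "\<exists>!d. ?P d"
    unfolding P_iff
  proof (rule ex1I[of _ d])
    show "0 < d \<and> d < \<rho> \<and> ?g d = 0" using d' d by simp
    fix e assume e: "0 < e \<and> e < \<rho> \<and> ?g e = 0"
    then show "e = d"
      using dec[of e d] dec[of d e] d d' by (cases e d rule: linorder_cases) auto
  qed
  from theI'[OF this] show "0 < d_star \<rho> \<alpha>" "d_star \<rho> \<alpha> < \<rho>"
    unfolding d_star_def by simp_all
qed

text \<open>With survival probability p and first rate p * d, the acceptance probability contributes
  p^\<alpha> and the bracket p (\<rho> - d) (1 + q / (1 - q)) one more p. So the income law enters
  only through \<open>x_bar\<close> times p^(\<alpha> + 1), the maximal revenue.\<close>

lemma grand_NPV_sym_beta:
  fixes \<rho> \<alpha> :: real
  assumes \<rho>: "0 < \<rho>" "\<rho> < 1" and \<alpha>: "0 < \<alpha>"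
  obtains K where "0 < K" "\<And>a. 0 < a \<Longrightarrow> grand_NPV \<rho> \<alpha> (sym_beta_density a) = K * max_revenue \<alpha> a"
proof
  define d where "d = d_star \<rho> \<alpha>"
  define q where "q = \<rho> * d powr \<alpha>"
  have d: "0 < d" "d < \<rho>" using d_star_bounds[OF \<rho> \<alpha>] by (simp_all add: d_def)
  have "d powr \<alpha> < 1" using d \<rho> \<alpha> powr_less_mono2[of \<alpha> d 1] by simp
  then have q: "0 < q" "q < 1"
    using d \<rho> mult_strict_mono[of \<rho> 1 "d powr \<alpha>" 1] by (simp_all add: q_def)
  \<comment> \<open>By the equation for \<open>d_star\<close>, \<alpha> (\<rho> - d) = d (1 - q), so
    this constant is d^(\<alpha> + 1) / \<alpha>, as in the closed form of the optimal NPV.\<close>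
  show "0 < d powr \<alpha> * (\<rho> - d) / (1 - q)"
    using d q by simp
  fix a :: real assume a: "0 < a"
  interpret real_distribution "beta_law a" using a by (rule real_distribution_beta_law)
  let ?m = "x_bar \<alpha> (sym_beta_density a)"
  define p where "p = 1 - beta_cdf a ?m"
  have p: "0 < p"
    using beta_cdf_less_1[OF a, of ?m] x_bar_beta_pos[OF a \<alpha>] x_bar_beta_less_1[OF a \<alpha>]
    by (simp add: p_def)
  \<comment> \<open>Repayment is the event \<theta> \<ge> m, whereas 1 - F(m) is the probability of
    \<theta> > m; they agree because the law has no atoms.\<close>
  have "prob {?m} = 0"
    using continuous_beta_cdf[OF a, of UNIV] by (simp add: continuous_on_eq_continuous_at isCont_cdf)
  moreover have "prob {..?m} + prob {?m..} = prob UNIV + prob {?m}"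
  proof -
    have "prob UNIV = prob {..<?m} + prob {?m..}"
      by (subst finite_measure_Union[symmetric]) (auto intro!: arg_cong[where f = prob])
    moreover have "prob {..?m} = prob {..<?m} + prob {?m}"
      by (subst finite_measure_Union[symmetric]) (auto intro!: arg_cong[where f = prob])
    ultimately show ?thesis by simp
  qed
  ultimately have surv: "prob {?m..} = p"
    using prob_space by (simp add: p_def cdf_def)
  have "grand_NPV \<rho> \<alpha> (sym_beta_density a) = (p * d) powr \<alpha> * ?m *
      (\<rho> * p - p * d + p * (\<rho> - d) * q / (1 - q))"
    using lender_NPV_two_rates[of "beta_law a" ?m "grand_d \<rho> \<alpha> (sym_beta_density a)" d \<rho> "\<lambda>d. d powr \<alpha>"]
      prob_space_axioms surv p q
    by (simp add: grand_NPV_def grand_y_def[abs_def] grand_d_def d_def[symmetric] p_def[symmetric] q_def[symmetric])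
  also have "\<rho> * p - p * d + p * (\<rho> - d) * q / (1 - q) = p * (\<rho> - d) / (1 - q)"
    using q by (simp add: field_simps)
  also have "(p * d) powr \<alpha> = p powr \<alpha> * d powr \<alpha>"
    using p d by (simp add: powr_mult)
  finally show "grand_NPV \<rho> \<alpha> (sym_beta_density a) = d powr \<alpha> * (\<rho> - d) / (1 - q) * max_revenue \<alpha> a"
    using p by (simp add: max_revenue_def revenue_def p_def[symmetric] powr_add)
qed

section \<open>The supremum, the variance parameter and the conclusion\<close>

lemma sup_NPV_eq_grand_NPV:
  assumes "grand_optimal \<rho> \<alpha> f"
  shows "sup_NPV \<rho> (\<lambda>d. d powr \<alpha>) (income_law f) = grand_NPV \<rho> \<alpha> f"
  unfolding sup_NPV_def grand_NPV_def
  using assms by (intro cSup_eq_maximum) (force simp: grand_optimal_def optimal_policy_def)+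

lemma shape_of_variance_variance: "0 < a \<Longrightarrow> shape_of_variance (1 / (4 * (2 * a + 1))) = a"
  by (simp add: shape_of_variance_def field_simps)

lemma shape_of_variance_less: "0 < v \<Longrightarrow> v < w \<Longrightarrow> shape_of_variance w < shape_of_variance v"
  by (simp add: shape_of_variance_def frac_less2)

lemma shape_of_variance_pos: "0 < v \<Longrightarrow> v < 1/4 \<Longrightarrow> 0 < shape_of_variance v"
  using shape_of_variance_less[of v "1/4"] by (simp add: shape_of_variance_def)

text \<open>The first conjunct certifies that v is the variance while the mean stays 1/2. The
  behaviour in v is asserted for the grand experiment at every v, and for the supremum over all
  policies at those v where the grand experiment is optimal, since optimality can fail.\<close>

theorem proposition5p1:
  fixes \<rho> \<alpha> :: real
  assumes "0 < \<rho>" "\<rho> < 1" "0 < \<alpha>" "\<alpha> < 1"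
  shows "(\<forall>a>0. prob_space (income_law (sym_beta_density a)) \<and>
            prob_space.expectation (income_law (sym_beta_density a)) (\<lambda>\<theta>. \<theta>) = 1/2 \<and>
            prob_space.variance (income_law (sym_beta_density a)) (\<lambda>\<theta>. \<theta>) = 1 / (4 * (2 * a + 1)) \<and>
            shape_of_variance (1 / (4 * (2 * a + 1))) = a) \<and>
         (\<exists>v0. 0 < v0 \<and> v0 < 1/4 \<and>
            strict_antimono_on {0<..v0} (\<lambda>v. grand_NPV \<rho> \<alpha> (density_of_variance v)) \<and>
            strict_mono_on {v0..<1/4} (\<lambda>v. grand_NPV \<rho> \<alpha> (density_of_variance v)) \<and>
            strict_antimono_on {v \<in> {0<..v0}. grand_optimal \<rho> \<alpha> (density_of_variance v)}
              (\<lambda>v. sup_NPV \<rho> (\<lambda>d. d powr \<alpha>) (income_law (density_of_variance v))) \<and>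
            strict_mono_on {v \<in> {v0..<1/4}. grand_optimal \<rho> \<alpha> (density_of_variance v)}
              (\<lambda>v. sup_NPV \<rho> (\<lambda>d. d powr \<alpha>) (income_law (density_of_variance v))))"
proof -
  let ?V = "\<lambda>v. grand_NPV \<rho> \<alpha> (density_of_variance v)"
  obtain K where K: "0 < K"
    "\<And>a. 0 < a \<Longrightarrow> grand_NPV \<rho> \<alpha> (sym_beta_density a) = K * max_revenue \<alpha> a"
    using grand_NPV_sym_beta assms by metis
  obtain a0 where a0: "0 < a0" "sym_beta_density a0 (1/2) = 1 / (\<alpha> + 1)"
    using ex_sym_beta_density_half_eq assms by metis
  \<comment> \<open>At shape a0 the point \<open>x_bar\<close> is exactly 1/2; v0 is the variance of
    that law.\<close>
  define v0 where "v0 = 1 / (4 * (2 * a0 + 1))"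
  have v0: "0 < v0" "v0 < 1/4" "shape_of_variance v0 = a0"
    using a0 shape_of_variance_variance[of a0] by (simp_all add: v0_def)
  \<comment> \<open>Shape decreases in variance: up to v0 the shapes are at least a0, where the
    maximal revenue grows with the shape and hence falls with v. Beyond v0 both directions
    turn.\<close>
  have less: "?V w < ?V v" if "0 < v" "v < w" "w \<le> v0" for v w
  proof -
    have pos: "0 < shape_of_variance w" using that v0 by (intro shape_of_variance_pos) auto
    have lt: "shape_of_variance w < shape_of_variance v" using that by (intro shape_of_variance_less)
    have "a0 \<le> shape_of_variance w"
      using that v0 shape_of_variance_less[of w v0] by (cases "w = v0") auto
    then have "1 / (\<alpha> + 1) \<le> sym_beta_density (shape_of_variance w) (1/2)"
      using a0 sym_beta_density_half_less[of a0 "shape_of_variance w"]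
      by (cases "a0 = shape_of_variance w") auto
    then show ?thesis
      using max_revenue_strict_mono_right[OF pos lt] assms K pos lt by simp
  qed
  have greater: "?V v < ?V w" if "v0 \<le> v" "v < w" "w < 1/4" for v w
  proof -
    have pos: "0 < shape_of_variance w" using that v0 by (intro shape_of_variance_pos) auto
    have lt: "shape_of_variance w < shape_of_variance v" using that v0 by (intro shape_of_variance_less) auto
    have "shape_of_variance v \<le> a0"
      using that v0 shape_of_variance_less[of v0 v] by (cases "v = v0") auto
    then have "sym_beta_density (shape_of_variance v) (1/2) \<le> 1 / (\<alpha> + 1)"
      using a0 sym_beta_density_half_less[of "shape_of_variance v" a0] pos lt
      by (cases "shape_of_variance v = a0") auto
    then show ?thesis
      using max_revenue_strict_mono_left[OF pos lt] assms K pos lt by simp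
  qed
  have "strict_antimono_on {0<..v0} ?V" "strict_mono_on {v0..<1/4} ?V"
    using less greater by (auto simp: monotone_on_def)
  moreover have "strict_antimono_on {v \<in> {0<..v0}. grand_optimal \<rho> \<alpha> (density_of_variance v)}
              (\<lambda>v. sup_NPV \<rho> (\<lambda>d. d powr \<alpha>) (income_law (density_of_variance v)))"
    using less by (auto simp: monotone_on_def sup_NPV_eq_grand_NPV)
  moreover have "strict_mono_on {v \<in> {v0..<1/4}. grand_optimal \<rho> \<alpha> (density_of_variance v)}
              (\<lambda>v. sup_NPV \<rho> (\<lambda>d. d powr \<alpha>) (income_law (density_of_variance v)))"
    using greater by (auto simp: monotone_on_def sup_NPV_eq_grand_NPV)
  ultimately have "\<exists>v0. 0 < v0 \<and> v0 < 1/4 \<and>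
            strict_antimono_on {0<..v0} ?V \<and> strict_mono_on {v0..<1/4} ?V \<and>
            strict_antimono_on {v \<in> {0<..v0}. grand_optimal \<rho> \<alpha> (density_of_variance v)}
              (\<lambda>v. sup_NPV \<rho> (\<lambda>d. d powr \<alpha>) (income_law (density_of_variance v))) \<and>
            strict_mono_on {v \<in> {v0..<1/4}. grand_optimal \<rho> \<alpha> (density_of_variance v)}
              (\<lambda>v. sup_NPV \<rho> (\<lambda>d. d powr \<alpha>) (income_law (density_of_variance v)))"
    using v0 by blast
  then show ?thesis
    using prob_space_beta_law expectation_beta_law variance_beta_law shape_of_variance_variance by blast
qed

end
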